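(* Let $n\ge1$. For any four arbitrary finite real numbers $r,\alpha,\beta,s$ in one of the following cases: (1) $r=\alpha<\beta<s$; (2) $r<\alpha=\beta<s$; (3) $r<\alpha<\beta=s$; (4) $r=\alpha=\beta<s$; (5) $r=\alpha<\beta=s$; (6) $r<\alpha=\beta=s$, one can choose a suitable radial initial data $\varphi(x)=\varphi(|x|)$, $x\in\mathbb{R}^n$, with $\varphi\in C^0[0,\infty)\cap L^\infty[0,\infty)$, satisfying $$\liminf_{\tau\to\infty}\varphi(\tau)=r,\qquad \limsup_{\tau\to\infty}\varphi(\tau)=s,$$ and such that its corresponding convolution solution $u(x,t)$ of the heat equation satisfies $$\liminf_{t\to\infty}u(0,t)=\alpha,\qquad \limsup_{t\to\infty}u(0,t)=\beta.$$
   Context: The convolution solution of $u_t=\Delta u$ on $\mathbb{R}^n\times(0,\infty)$, $u(x,0)=\varphi(x)$, with $\varphi$ continuous and bounded on $\mathbb{R}^n$, is $u(x,t)=\frac{1}{(4\pi t)^{n/2}}\int_{\mathbb{R}^n}e^{-|x-y|^2/(4t)}\varphi(y)\,dy$. A radial function is written $\varphi(x)=\varphi(\tau)$ with $\tau=|x|\in[0,\infty)$. *)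

theory Defs
  imports "HOL-Analysis.Analysis"
begin

(* Only meaningful for t > 0; for bounded continuous \<phi> the integrand is then integrable. *)
definition heat_convolution :: "('a::euclidean_space \<Rightarrow> real) \<Rightarrow> 'a \<Rightarrow> real \<Rightarrow> real" where
  "heat_convolution \<phi> x t =
     1 / (4 * pi * t) powr (real DIM('a) / 2) *
     (LINT y|lborel. exp (- (norm (x - y))\<^sup>2 / (4 * t)) * \<phi> y)"

end

theory Submission
  imports Defs "HOL-Probability.Distributions" "HOL-Real_Asymp.Real_Asymp"
begin

text \<open>
  If \<open>\<psi>(c\<tau>) - \<psi>(\<tau>) \<rightarrow> 0\<close> for every \<open>c > 0\<close>, then rescaling the Gaussian integral and dominated
  convergence give \<open>u(0,t) - \<psi>(\<surd>t) \<rightarrow> 0\<close>. Taking \<open>\<psi>\<close> affine in \<open>sin (ln (1 + ln (1 + \<tau>)))\<close>, so that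
  it oscillates between \<open>\<alpha>\<close> and \<open>\<beta>\<close>, gives \<open>u(0,t)\<close> the required limits. To produce \<open>r\<close> and \<open>s\<close>,
  change \<open>\<psi>\<close> on thin annuli around the integer radii of finite total volume, pushing it to \<open>s\<close> at
  even and to \<open>r\<close> at odd radii: an integrable perturbation contributes \<open>O(t\<^sup>-\<^sup>n\<^sup>/\<^sup>2)\<close> to \<open>u(0,t)\<close>.
\<close>

section \<open>Computing upper and lower limits from a sequence\<close>

text \<open>The eventual bounds \<open>L + e\<close> give \<open>\<le>\<close>. Conversely, eventual
  strict upper bounds along \<open>F\<close> pass to the sequence \<open>X\<close>, so the limit
  superior along \<open>X\<close>, which is \<open>L\<close>, cannot exceed the one along
  \<open>F\<close>.\<close>

lemma Limsup_eqI:
  fixes f :: "'a \<Rightarrow> real"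
  assumes upper: "\<And>e. e > 0 \<Longrightarrow> eventually (\<lambda>x. f x < L + e) F"
    and X: "filterlim X F sequentially" and lim: "(\<lambda>k. f (X k)) \<longlonglongrightarrow> L"
  shows "Limsup F (\<lambda>x. ereal (f x)) = ereal L"
proof (rule antisym)
  show "Limsup F (\<lambda>x. ereal (f x)) \<le> ereal L"
    unfolding Limsup_le_iff
  proof (intro allI impI)
    fix y assume y: "ereal L < y"
    show "\<forall>\<^sub>F x in F. ereal (f x) < y"
    proof (cases y)
      case (real v)
      then show ?thesis using upper[of "v - L"] y by simp
    qed (use y in auto)
  qed
  have "Limsup sequentially (\<lambda>k. ereal (f (X k))) = ereal L"
    using lim by (intro lim_imp_Limsup trivial_limit_sequentially tendsto_ereal)
  moreover have "Limsup sequentially (\<lambda>k. ereal (f (X k))) \<le> Limsup F (\<lambda>x. ereal (f x))"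
    unfolding Limsup_le_iff by (intro allI impI eventually_compose_filterlim[OF Limsup_lessD X])
  ultimately show "ereal L \<le> Limsup F (\<lambda>x. ereal (f x))" by (rule subst)
qed

lemma Liminf_eqI:
  fixes f :: "'a \<Rightarrow> real"
  assumes lower: "\<And>e. e > 0 \<Longrightarrow> eventually (\<lambda>x. L - e < f x) F"
    and X: "filterlim X F sequentially" and lim: "(\<lambda>k. f (X k)) \<longlonglongrightarrow> L"
  shows "Liminf F (\<lambda>x. ereal (f x)) = ereal L"
proof -
  have "Limsup F (\<lambda>x. ereal (- f x)) = ereal (- L)"
  proof (rule Limsup_eqI[OF _ X])
    show "\<forall>\<^sub>F x in F. - f x < - L + e" if "e > 0" for e
      using lower[OF that] by eventually_elim auto
    show "(\<lambda>k. - f (X k)) \<longlonglongrightarrow> - L"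
      using lim by (rule tendsto_minus)
  qed
  then have "- Liminf F (\<lambda>x. ereal (f x)) = - ereal L"
    using ereal_Limsup_uminus[of F "\<lambda>x. ereal (f x)"] by simp
  then show ?thesis by (simp only: ereal_uminus_eq_iff)
qed

section \<open>A radial bump around the integer radii\<close>

text \<open>If the norms of points of \<open>C\<close> converge, the points are bounded, so a
  subsequence converges; its limit lies in \<open>C\<close> and has the limiting norm. This provides
  the closed set of radii needed for Urysohn's lemma on the line.\<close>

lemma closed_norm_image:
  fixes C :: "'a::euclidean_space set"
  assumes "closed C"
  shows "closed (norm ` C)"
proof -
  have "l \<in> norm ` C" if x: "\<And>n. x n \<in> norm ` C" and l: "x \<longlonglongrightarrow> l" for x l
  proof -
    have "\<exists>z. z \<in> C \<and> norm z = x n" for n using x[of n] by auto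
    then obtain y where y: "\<And>n. y n \<in> C" "\<And>n. norm (y n) = x n"
      by metis
    obtain B where "\<And>n. norm (x n) \<le> B"
      using convergent_imp_bounded[OF l] unfolding bounded_iff by blast
    then have "norm (y n) \<le> B" for n by (metis y(2) abs_le_D1 real_norm_def)
    then have "bounded (range y)" by (auto intro: boundedI)
    then obtain z g where g: "strict_mono g" and z: "(\<lambda>n. y (g n)) \<longlonglongrightarrow> z"
      using bounded_imp_convergent_subsequence[of y] by (auto simp: o_def)
    have "z \<in> C" using closed_sequentially[OF assms _ z] y(1) by simp
    moreover have "norm z = l"
    proof (rule LIMSEQ_unique)
      show "(\<lambda>n. x (g n)) \<longlonglongrightarrow> norm z" using tendsto_norm[OF z] by (simp add: y(2))
      show "(\<lambda>n. x (g n)) \<longlonglongrightarrow> l" using LIMSEQ_subseq_LIMSEQ[OF l g] by (simp add: o_def)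
    qed
    ultimately show ?thesis by auto
  qed
  then show ?thesis unfolding closed_sequential_limits by blast
qed

lemma null_set_norm_Nats: "{y :: 'a::euclidean_space. norm y \<in> \<nat>} \<in> null_sets lebesgue"
proof -
  have "{y :: 'a. norm y \<in> \<nat>} = (\<Union>k. sphere 0 (real k))"
    by (auto simp: Nats_def)
  moreover have "sphere (0::'a) (real k) \<in> null_sets lebesgue" for k
    using negligible_iff_null_sets negligible_sphere by blast
  ultimately show ?thesis by (auto intro: null_sets_UN)
qed

text \<open>The set of points of integer norm is null, so it has an open neighbourhood \<open>V\<close> of finite
  measure; since the norm is a closed map, the bump can be chosen radial.\<close>

lemma radial_bump:
  obtains b :: "real \<Rightarrow> real" and V :: "'a::euclidean_space set"
  where "continuous_on UNIV b" "\<And>\<tau>. 0 \<le> b \<tau>" "\<And>\<tau>. b \<tau> \<le> 1" "\<And>k. b (real k) = 1"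
    "V \<in> sets borel" "emeasure lborel V < \<infinity>" "\<And>y. b (norm y) \<le> indicator V y"
proof -
  define N where "N = {y :: 'a. norm y \<in> \<nat>}"
  have N: "N \<in> null_sets lebesgue" unfolding N_def by (rule null_set_norm_Nats)
  then have "N \<in> sets lebesgue" by blast
  \<comment> \<open>The excess 1 is an arbitrary choice: any finite excess over the null set
    \<open>N\<close> makes \<open>V\<close> of finite measure.\<close>
  then obtain V where V: "open V" "N \<subseteq> V" "V - N \<in> lmeasurable"
    by (rule sets_lebesgue_outer_open[OF _ zero_less_one])
  have "V = (V - N) \<union> N" using V by auto
  moreover have "N \<in> lmeasurable" using N by (rule fmeasurableI_null_sets)
  then have "(V - N) \<union> N \<in> lmeasurable" using V(3) by (intro fmeasurable.Un)
  ultimately have "V \<in> lmeasurable" by (rule ssubst)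
  then have V_fin: "emeasure lborel V < \<infinity>"
    using V(1) by (auto simp: fmeasurable_def main_part_sets)
  \<comment> \<open>Urysohn's lemma is applied to radii: a point of integer norm lies in
    \<open>V\<close>, so no norm of a point outside \<open>V\<close> is an integer. Vanishing of
    \<open>b\<close> on those norms then bounds \<open>b (norm y)\<close> by the indicator of
    \<open>V\<close>.\<close>
  have "closed (norm ` (- V))" using V(1) by (intro closed_norm_image) auto
  moreover have "norm ` (- V) \<inter> \<nat> = {}" using V(2) by (auto simp: N_def)
  ultimately obtain b :: "real \<Rightarrow> real" where b: "continuous_on UNIV b"
    "\<And>\<tau>. b \<tau> \<in> closed_segment 0 1" "\<And>\<tau>. \<tau> \<in> norm ` (- V) \<Longrightarrow> b \<tau> = 0" "\<And>\<tau>. \<tau> \<in> \<nat> \<Longrightarrow> b \<tau> = 1"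
    using Urysohn[of "norm ` (- V)" "\<nat>" "0::real" 1] closed_Nats by metis
  show thesis
  proof (rule that[of b V])
    show "0 \<le> b \<tau>" "b \<tau> \<le> 1" for \<tau>
      using b(2)[of \<tau>] by (auto simp: closed_segment_eq_real_ivl)
    then show "b (norm y) \<le> indicator V y" for y
      using b(3)[of "norm y"] by (auto simp: indicator_def)
  qed (use b V V_fin in auto)
qed

section \<open>The Gaussian kernel and basic rules for the convolution at the origin\<close>

text \<open>The Gaussian factors over the coordinates into centred normal densities of variance
  \<open>2 * t\<close>, each multiplied by \<open>sqrt (4 * pi * t)\<close> to undo its
  normalisation. Each coordinate therefore contributes exactly that factor.\<close>

lemma has_bochner_integral_heat_kernel:
  assumes "t > 0"
  shows "has_bochner_integral lborel
    (\<lambda>y :: 'a::euclidean_space. exp (- (norm y)\<^sup>2 / (4 * t))) ((4 * pi * t) powr (real DIM('a) / 2))"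
proof (rule has_bochner_integral_nn_integral)
  have *: "exp (- (norm y)\<^sup>2 / (4 * t)) = 
     (\<Prod>b\<in>Basis. sqrt (4 * pi * t) * normal_density 0 (sqrt (2 * t)) (y \<bullet> b))" for y :: 'a
  proof -
    have "(\<Sum>b\<in>Basis. - (y \<bullet> b)\<^sup>2 / (4 * t)) = - (norm y)\<^sup>2 / (4 * t)"
      by (simp add: sum_divide_distrib[symmetric] sum_negf euclidean_inner[of y y] power2_norm_eq_inner flip: power2_eq_square)
    moreover have "sqrt (4 * pi * t) * normal_density 0 (sqrt (2 * t)) x = exp (- x\<^sup>2 / (4 * t))" for x
      using assms by (simp add: normal_density_def real_sqrt_mult algebra_simps)
    ultimately show ?thesis by (simp add: exp_sum[symmetric])
  qed
  have "(\<integral>\<^sup>+ y. ennreal (exp (- (norm (y::'a))\<^sup>2 / (4 * t))) \<partial>lborel) =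
    (\<integral>\<^sup>+ y. (\<Prod>b\<in>Basis. ennreal (sqrt (4 * pi * t) * normal_density 0 (sqrt (2 * t)) ((y::'a) \<bullet> b))) \<partial>lborel)"
    using assms unfolding * by (subst prod_ennreal) auto
  also have "\<dots> = (\<Prod>b\<in>(Basis::'a set). \<integral>\<^sup>+ x. ennreal (sqrt (4 * pi * t) * normal_density 0 (sqrt (2 * t)) x) \<partial>lborel)"
    by (rule nn_integral_lborel_prod) (use assms in auto)
  also have "(\<integral>\<^sup>+ x. ennreal (sqrt (4 * pi * t) * normal_density 0 (sqrt (2 * t)) x) \<partial>lborel) = ennreal (sqrt (4 * pi * t))"
    using assms by (subst nn_integral_eq_integral) auto
  also have "(\<Prod>b\<in>(Basis::'a set). ennreal (sqrt (4 * pi * t))) = ennreal (sqrt (4 * pi * t) ^ DIM('a))"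
    using assms by (simp add: ennreal_power)
  also have "sqrt (4 * pi * t) ^ DIM('a) = (4 * pi * t) powr (real DIM('a) / 2)"
    using assms by (simp add: powr_half_sqrt[symmetric] powr_powr powr_realpow[symmetric])
  finally show "(\<integral>\<^sup>+ y. ennreal (exp (- (norm (y::'a))\<^sup>2 / (4 * t))) \<partial>lborel) = ennreal ((4 * pi * t) powr (real DIM('a) / 2))" .
qed auto

lemma integrable_heat_integrand:
  fixes f :: "'a::euclidean_space \<Rightarrow> real"
  assumes "t > 0" and [measurable]: "f \<in> borel_measurable borel" and "\<And>y. \<bar>f y\<bar> \<le> M"
  shows "integrable lborel (\<lambda>y. exp (- (norm (0 - y))\<^sup>2 / (4 * t)) * f y)"
proof (rule Bochner_Integration.integrable_bound)
  show "integrable lborel (\<lambda>y::'a. exp (- (norm y)\<^sup>2 / (4 * t)) * M)"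
    using has_bochner_integral_heat_kernel[OF assms(1), where 'a='a]
    by (auto simp: has_bochner_integral_iff)
  have "\<bar>f y\<bar> \<le> \<bar>M\<bar>" for y using assms(3)[of y] by linarith
  then show "AE y in lborel. norm (exp (- (norm (0 - y))\<^sup>2 / (4 * t)) * f y)
      \<le> norm (exp (- (norm y)\<^sup>2 / (4 * t)) * M)"
    by (auto simp: abs_mult intro!: mult_left_mono)
qed measurable

lemma heat_convolution_const:
  assumes "t > 0"
  shows "heat_convolution (\<lambda>_ :: 'a::euclidean_space. c) 0 t = c"
  using has_bochner_integral_heat_kernel[OF assms, where 'a='a] assms
  by (simp add: heat_convolution_def has_bochner_integral_iff)

lemma heat_convolution_diff:
  fixes f g :: "'a::euclidean_space \<Rightarrow> real"
  assumes "t > 0" "f \<in> borel_measurable borel" "\<And>y. \<bar>f y\<bar> \<le> M"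
    "g \<in> borel_measurable borel" "\<And>y. \<bar>g y\<bar> \<le> M'"
  shows "heat_convolution (\<lambda>y. f y - g y) 0 t = heat_convolution f 0 t - heat_convolution g 0 t"
proof -
  note integrable_heat_integrand[OF assms(1-3)] integrable_heat_integrand[OF assms(1,4,5)]
  from Bochner_Integration.integral_diff[OF this] show ?thesis
    by (simp only: heat_convolution_def right_diff_distrib)
qed

text \<open>Substitute \<open>y = sqrt t *\<^sub>R z\<close>: the Jacobian
  \<open>sqrt t ^ DIM('a)\<close> cancels the power of \<open>t\<close> in the normalisation,
  leaving a kernel independent of \<open>t\<close>.\<close>

lemma heat_convolution_rescale:
  fixes f :: "'a::euclidean_space \<Rightarrow> real"
  assumes "t > 0" and [measurable]: "f \<in> borel_measurable borel"
  shows "heat_convolution f 0 t = heat_convolution (\<lambda>z. f (sqrt t *\<^sub>R z)) 0 1"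
proof -
  have "(LINT y|lborel. exp (- (norm y)\<^sup>2 / (4 * t)) * f y) =
    (LINT y|density (distr lborel borel (\<lambda>x::'a. 0 + sqrt t *\<^sub>R x)) (\<lambda>_. \<bar>sqrt t\<bar>^DIM('a)). exp (- (norm y)\<^sup>2 / (4 * t)) * f y)"
    using assms(1) by (subst lborel_affine[of "sqrt t" 0]) auto
  also have "\<dots> = sqrt t ^ DIM('a) * (LINT z|lborel. exp (- (norm z)\<^sup>2 / 4) * f (sqrt t *\<^sub>R z))"
    using assms(1) by (subst integral_density) (auto simp: integral_distr power_mult_distrib)
  also have "sqrt t ^ DIM('a) = t powr (real DIM('a) / 2)"
    using assms(1) by (simp add: powr_half_sqrt[symmetric] powr_powr powr_realpow[symmetric])
  finally show ?thesis
    using assms(1) by (simp add: heat_convolution_def powr_mult)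
qed

section \<open>Large-time behaviour at the origin\<close>

text \<open>The exponential is at most 1, so the integral stays below
  \<open>M * measure lborel V\<close> for all \<open>t > 0\<close>, while the prefactor decays
  because the dimension is positive.\<close>

lemma heat_convolution_finite_measure_support_tendsto_0:
  fixes f :: "'a::euclidean_space \<Rightarrow> real"
  assumes [measurable]: "f \<in> borel_measurable borel" "V \<in> sets borel"
    and "emeasure lborel V < \<infinity>" and f: "\<And>y. \<bar>f y\<bar> \<le> M * indicator V y"
  shows "((\<lambda>t. heat_convolution f 0 t) \<longlongrightarrow> 0) at_top"
proof (rule Lim_null_comparison)
  have int: "integrable lborel (\<lambda>y. M * indicator V y)"
    using assms(3) by (intro integrable_mult_right) auto
  show "\<forall>\<^sub>F t in at_top. norm (heat_convolution f 0 t) \<le>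
      1 / (4 * pi * t) powr (real DIM('a) / 2) * (M * measure lborel V)"
    using eventually_gt_at_top[of 0]
  proof eventually_elim
    case (elim t)
    have le: "\<bar>exp (- (norm (0 - y))\<^sup>2 / (4 * t)) * f y\<bar> \<le> M * indicator V y" for y
    proof -
      have "exp (- (norm (0 - y))\<^sup>2 / (4 * t)) \<le> 1" using elim by simp
      then have "exp (- (norm (0 - y))\<^sup>2 / (4 * t)) * \<bar>f y\<bar> \<le> 1 * \<bar>f y\<bar>"
        by (intro mult_right_mono) auto
      with f[of y] show ?thesis by (simp add: abs_mult)
    qed
    have "\<bar>LINT y|lborel. exp (- (norm (0 - y))\<^sup>2 / (4 * t)) * f y\<bar> \<le> (LINT y|lborel. M * indicator V y)"
      using le by (intro integral_abs_bound_integral int Bochner_Integration.integrable_bound[OF int])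
        (auto intro: order_trans[OF _ abs_ge_self])
    then show ?case
      by (auto simp: heat_convolution_def abs_mult intro!: divide_right_mono)
  qed
  have "((\<lambda>t. 1 / (4 * pi * t) powr (real DIM('a) / 2)) \<longlongrightarrow> 0) at_top"
    using DIM_positive[where 'a='a] by real_asymp
  then show "((\<lambda>t. 1 / (4 * pi * t) powr (real DIM('a) / 2) * (M * measure lborel V)) \<longlongrightarrow> 0) at_top"
    by (rule tendsto_mult_left_zero)
qed

text \<open>The kernel at time 1 reproduces the constant \<open>\<psi> (sqrt t)\<close>, so after
  rescaling the difference is the Gaussian integral of
  \<open>\<psi> (norm z * sqrt t) - \<psi> (sqrt t)\<close>. This tends to 0 pointwise by
  \<open>slow\<close> with \<open>c = norm z\<close>, and is dominated by
  \<open>2 * M\<close>.\<close>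

lemma heat_convolution_slowly_varying:
  fixes \<psi> :: "real \<Rightarrow> real"
  assumes [measurable]: "\<psi> \<in> borel_measurable borel" and bd: "\<And>\<tau>. \<bar>\<psi> \<tau>\<bar> \<le> M"
    and slow: "\<And>c. c > 0 \<Longrightarrow> ((\<lambda>\<tau>. \<psi> (c * \<tau>) - \<psi> \<tau>) \<longlongrightarrow> 0) at_top"
  shows "((\<lambda>t. heat_convolution (\<lambda>x :: 'a::euclidean_space. \<psi> (norm x)) 0 t - \<psi> (sqrt t)) \<longlongrightarrow> 0) at_top"
proof -
  have "((\<lambda>t. LINT z|lborel. exp (- (norm (0 - z))\<^sup>2 / (4 * 1)) * (\<psi> (norm (sqrt t *\<^sub>R (z::'a))) - \<psi> (sqrt t)))
      \<longlongrightarrow> (LINT z|(lborel :: 'a measure). (0::real))) at_top"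
  proof (rule integral_dominated_convergence_at_top)
    show "integrable lborel (\<lambda>z::'a. exp (- (norm (0 - z))\<^sup>2 / (4 * 1)) * (2 * M))"
      by (rule integrable_heat_integrand[where M="\<bar>2 * M\<bar>"]) auto
    have "\<bar>\<psi> x - \<psi> y\<bar> \<le> 2 * M" for x y using bd[of x] bd[of y] by linarith
    then show "\<forall>\<^sub>F t in at_top. AE z in lborel. norm (exp (- (norm (0 - z))\<^sup>2 / (4 * 1)) *
        (\<psi> (norm (sqrt t *\<^sub>R (z::'a))) - \<psi> (sqrt t))) \<le> exp (- (norm (0 - z))\<^sup>2 / (4 * 1)) * (2 * M)"
      by (auto simp: abs_mult)
    \<comment> \<open>The origin is discarded since \<open>slow\<close> is available for positive
      factors \<open>c = norm z\<close>.\<close>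
    have "AE z in lborel. z \<noteq> (0::'a)" by (rule AE_lborel_singleton)
    then show "AE z in lborel. ((\<lambda>t. exp (- (norm (0 - z))\<^sup>2 / (4 * 1)) *
        (\<psi> (norm (sqrt t *\<^sub>R (z::'a))) - \<psi> (sqrt t))) \<longlongrightarrow> 0) at_top"
    proof eventually_elim
      case (elim z)
      have "((\<lambda>t. \<psi> (norm z * sqrt t) - \<psi> (sqrt t)) \<longlongrightarrow> 0) at_top"
        using filterlim_compose[OF slow sqrt_at_top] elim by auto
      moreover have "\<forall>\<^sub>F t in at_top. \<psi> (norm z * sqrt t) - \<psi> (sqrt t) = \<psi> (norm (sqrt t *\<^sub>R z)) - \<psi> (sqrt t)"
        using eventually_gt_at_top[of 0] by eventually_elim (simp add: mult.commute)
      ultimately have "((\<lambda>t. \<psi> (norm (sqrt t *\<^sub>R z)) - \<psi> (sqrt t)) \<longlongrightarrow> 0) at_top"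
        by (rule Lim_transform_eventually)
      then show ?case by (rule tendsto_mult_right_zero)
    qed
  qed measurable
  then have "((\<lambda>t. heat_convolution (\<lambda>z::'a. \<psi> (norm (sqrt t *\<^sub>R z)) - \<psi> (sqrt t)) 0 1) \<longlongrightarrow> 0) at_top"
    unfolding heat_convolution_def by (intro tendsto_mult_right_zero) simp
  moreover have "\<forall>\<^sub>F t in at_top. heat_convolution (\<lambda>z::'a. \<psi> (norm (sqrt t *\<^sub>R z)) - \<psi> (sqrt t)) 0 1 =
    heat_convolution (\<lambda>x::'a. \<psi> (norm x)) 0 t - \<psi> (sqrt t)"
    using eventually_gt_at_top[of 0]
  proof eventually_elim
    case (elim t)
    have "heat_convolution (\<lambda>z::'a. \<psi> (norm (sqrt t *\<^sub>R z)) - \<psi> (sqrt t)) 0 1 =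
      heat_convolution (\<lambda>z::'a. \<psi> (norm (sqrt t *\<^sub>R z))) 0 1 - heat_convolution (\<lambda>z::'a. \<psi> (sqrt t)) 0 1"
      by (rule heat_convolution_diff[where M=M and M'=M]) (auto simp: bd)
    also have "heat_convolution (\<lambda>z::'a. \<psi> (norm (sqrt t *\<^sub>R z))) 0 1 = heat_convolution (\<lambda>x::'a. \<psi> (norm x)) 0 t"
      using heat_convolution_rescale[OF elim, of "\<lambda>x::'a. \<psi> (norm x)"] by simp
    finally show ?case by (simp add: heat_convolution_const)
  qed
  ultimately show ?thesis by (rule Lim_transform_eventually)
qed

section \<open>A slowly varying oscillation\<close>

text \<open>With a single logarithm, scaling the argument by \<open>c\<close> would leave a phase
  shift tending to \<open>ln c\<close>; the second logarithm makes the shift vanish. The added ones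
  keep both logarithms nonnegative, and the absolute value extends the function continuously to the
  whole line.\<close>

definition slow_wave :: "real \<Rightarrow> real" where
  "slow_wave \<tau> = sin (ln (1 + ln (1 + \<bar>\<tau>\<bar>)))"

lemma continuous_slow_wave: "continuous_on UNIV slow_wave"
proof -
  have "0 < 1 + ln (1 + \<bar>x\<bar>)" for x :: real
    by (intro add_pos_nonneg) auto
  then have "1 + ln (1 + \<bar>x\<bar>) \<noteq> 0" for x :: real
    by (metis less_irrefl)
  moreover have "1 + \<bar>x\<bar> \<noteq> 0" for x :: real by linarith
  ultimately show ?thesis
    unfolding slow_wave_def by (intro continuous_intros) auto
qed

text \<open>Sine is 1-Lipschitz, so it suffices that the difference of the phases tends to
  0.\<close>

lemma slow_wave_slow:
  assumes "c > 0"
  shows "((\<lambda>\<tau>. slow_wave (c * \<tau>) - slow_wave \<tau>) \<longlongrightarrow> 0) at_top"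
proof (rule Lim_null_comparison)
  have "\<bar>sin x - sin y\<bar> \<le> \<bar>x - y\<bar>" for x y :: real
  proof -
    have "sin x - sin y = 2 * sin ((x - y) / 2) * cos ((x + y) / 2)" by (rule sin_diff_sin)
    then have "\<bar>sin x - sin y\<bar> \<le> 2 * \<bar>sin ((x - y) / 2)\<bar> * 1"
      by (simp only: abs_mult) (intro mult_mono; simp)
    also have "\<dots> \<le> \<bar>x - y\<bar>" using abs_sin_x_le_abs_x[of "(x - y) / 2"] by simp
    finally show ?thesis .
  qed
  then have "\<bar>slow_wave (c * \<tau>) - slow_wave \<tau>\<bar> \<le> \<bar>ln (1 + ln (1 + c * \<tau>)) - ln (1 + ln (1 + \<tau>))\<bar>"
    if "\<tau> \<ge> 0" for \<tau>
    using that assms by (simp add: slow_wave_def)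
  then show "\<forall>\<^sub>F \<tau> in at_top. norm (slow_wave (c * \<tau>) - slow_wave \<tau>) \<le>
      \<bar>ln (1 + ln (1 + c * \<tau>)) - ln (1 + ln (1 + \<tau>))\<bar>"
    by (auto intro: eventually_mono[OF eventually_ge_at_top[of 0]])
  show "((\<lambda>\<tau>. \<bar>ln (1 + ln (1 + c * \<tau>)) - ln (1 + ln (1 + \<tau>))\<bar>) \<longlongrightarrow> 0) at_top"
    using assms by (intro tendsto_rabs_zero) real_asymp
qed

text \<open>\<open>X k\<close> inverts the double logarithm at phase \<open>a + 2 * pi * k\<close>,
  and \<open>T k\<close> is its square. Nonnegativity of \<open>a\<close> gives
  \<open>X k \<ge> 0\<close>, so that \<open>sqrt ((X k)\<^sup>2)\<close> is
  \<open>X k\<close>.\<close>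

lemma slow_wave_attains:
  assumes "a \<ge> 0"
  obtains T where "filterlim T at_top sequentially" "\<And>k. slow_wave (sqrt (T k)) = sin a"
proof -
  define X where "X k = exp (exp (a + 2 * pi * real k) - 1) - 1" for k :: nat
  have "0 \<le> X k" for k using assms by (simp add: X_def)
  then have "slow_wave (sqrt ((X k)\<^sup>2)) = sin a" for k
    using sin_int_2pin[of "int k"] cos_int_2pin[of "int k"]
    by (simp add: slow_wave_def, simp add: X_def sin_add)
  moreover have "filterlim (\<lambda>k. (X k)\<^sup>2) at_top sequentially"
    unfolding X_def by real_asymp
  ultimately show thesis using that by blast
qed

section \<open>Construction of the initial data and its four limits\<close>

theorem theorem20:
  fixes r \<alpha> \<beta> s :: real
  assumes "(r = \<alpha> \<and> \<alpha> < \<beta> \<and> \<beta> < s) \<or>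
           (r < \<alpha> \<and> \<alpha> = \<beta> \<and> \<beta> < s) \<or>
           (r < \<alpha> \<and> \<alpha> < \<beta> \<and> \<beta> = s) \<or>
           (r = \<alpha> \<and> \<alpha> = \<beta> \<and> \<beta> < s) \<or>
           (r = \<alpha> \<and> \<alpha> < \<beta> \<and> \<beta> = s) \<or>
           (r < \<alpha> \<and> \<alpha> = \<beta> \<and> \<beta> = s)"
  shows "\<exists>\<phi> :: real \<Rightarrow> real.
           continuous_on {0..} \<phi> \<and>
           bounded (\<phi> ` {0..}) \<and>
           Liminf at_top (\<lambda>\<tau>. ereal (\<phi> \<tau>)) = ereal r \<and>
           Limsup at_top (\<lambda>\<tau>. ereal (\<phi> \<tau>)) = ereal s \<and>
           Liminf at_top (\<lambda>t. ereal (heat_convolution (\<lambda>x :: real ^ 'n. \<phi> (norm x)) 0 t)) = ereal \<alpha> \<and>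
           Limsup at_top (\<lambda>t. ereal (heat_convolution (\<lambda>x :: real ^ 'n. \<phi> (norm x)) 0 t)) = ereal \<beta>"
proof -
  \<comment> \<open>Each of the six cases yields this chain, from which one construction serves them
    all.\<close>
  have ord: "r \<le> \<alpha>" "\<alpha> \<le> \<beta>" "\<beta> \<le> s" using assms by auto
  obtain b :: "real \<Rightarrow> real" and V :: "(real ^ 'n) set"
    where b: "continuous_on UNIV b" "\<And>\<tau>. 0 \<le> b \<tau>" "\<And>\<tau>. b \<tau> \<le> 1" "\<And>k. b (real k) = 1"
      and V: "V \<in> sets borel" "emeasure lborel V < \<infinity>" and bV: "\<And>y. b (norm y) \<le> indicator V y"
    by (rule radial_bump) blast
  \<comment> \<open>The affine map sends the range [-1, 1] of the wave onto [\<alpha>, \<beta>].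
    Likewise \<open>g\<close> equals \<open>s\<close> at even and \<open>r\<close> at odd integers,
    and \<open>\<phi>\<close> is the convex combination of \<open>\<psi>\<close> and
    \<open>g\<close> with weight \<open>b\<close>, hence agrees with \<open>g\<close> at the integer
    radii.\<close>
  define \<psi> where "\<psi> \<tau> = (\<alpha> + \<beta>) / 2 + (\<beta> - \<alpha>) / 2 * slow_wave \<tau>" for \<tau>
  define g where "g \<tau> = (r + s) / 2 + (s - r) / 2 * cos (pi * \<tau>)" for \<tau>
  define \<phi> where "\<phi> \<tau> = \<psi> \<tau> + b \<tau> * (g \<tau> - \<psi> \<tau>)" for \<tau>
  define M where "M = \<bar>r\<bar> + \<bar>s\<bar>"
  have between: "p \<le> (p + q) / 2 + (q - p) / 2 * x \<and> (p + q) / 2 + (q - p) / 2 * x \<le> q"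
    if "p \<le> q" "-1 \<le> x" "x \<le> 1" for p q x :: real
  proof -
    have "0 \<le> (q - p) / 2 * (1 - x)" "0 \<le> (q - p) / 2 * (1 + x)"
      using that by (auto intro!: mult_nonneg_nonneg)
    then show ?thesis by (simp add: field_simps)
  qed
  have \<psi>: "\<alpha> \<le> \<psi> \<tau>" "\<psi> \<tau> \<le> \<beta>" for \<tau>
    using between[OF ord(2), of "slow_wave \<tau>"] by (auto simp: \<psi>_def slow_wave_def)
  have g: "r \<le> g \<tau>" "g \<tau> \<le> s" for \<tau>
    using between[of r s "cos (pi * \<tau>)"] ord by (auto simp: g_def)
  have \<phi>: "r \<le> \<phi> \<tau>" "\<phi> \<tau> \<le> s" for \<tau>
  proof -
    have eq: "\<phi> \<tau> = (1 - b \<tau>) * \<psi> \<tau> + b \<tau> * g \<tau>" by (simp add: \<phi>_def algebra_simps)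
    show "\<phi> \<tau> \<le> s" unfolding eq
      by (rule convex_bound_le) (use b(2,3)[of \<tau>] \<psi>[of \<tau>] g[of \<tau>] ord in auto)
    have "(1 - b \<tau>) * (- \<psi> \<tau>) + b \<tau> * (- g \<tau>) \<le> - r"
      by (rule convex_bound_le) (use b(2,3)[of \<tau>] \<psi>[of \<tau>] g[of \<tau>] ord in auto)
    then show "r \<le> \<phi> \<tau>" unfolding eq by simp
  qed
  have cont_\<psi>: "continuous_on UNIV \<psi>"
    unfolding \<psi>_def by (intro continuous_intros continuous_slow_wave)
  have cont_\<phi>: "continuous_on UNIV \<phi>"
    unfolding \<phi>_def g_def by (intro continuous_intros b cont_\<psi>)
  have [measurable]: "\<psi> \<in> borel_measurable borel" "\<phi> \<in> borel_measurable borel"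
    using cont_\<psi> cont_\<phi> by (auto intro: borel_measurable_continuous_onI)
  have M: "\<bar>\<psi> \<tau>\<bar> \<le> M" "\<bar>\<phi> \<tau>\<bar> \<le> M" for \<tau>
    using \<psi>[of \<tau>] \<phi>[of \<tau>] ord by (auto simp: M_def)
  define u where "u t = heat_convolution (\<lambda>x :: real ^ 'n. \<phi> (norm x)) 0 t" for t
  \<comment> \<open>Split \<open>\<phi>\<close> as \<open>(\<phi> - \<psi>) + \<psi>\<close>: the
    first summand vanishes outside the set \<open>V\<close> of finite measure, the second is slowly
    varying.\<close>
  have "((\<lambda>t. u t - \<psi> (sqrt t)) \<longlongrightarrow> 0) at_top"
  proof -
    have "\<bar>\<phi> (norm y) - \<psi> (norm y)\<bar> \<le> (s - r) * indicator V y" for y :: "real ^ 'n"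
    proof -
      have "\<bar>g (norm y) - \<psi> (norm y)\<bar> \<le> s - r"
        \<comment> \<open>Both values lie in [r, s].\<close>
        using g[of "norm y"] \<psi>[of "norm y"] ord by linarith
      then have "b (norm y) * \<bar>g (norm y) - \<psi> (norm y)\<bar> \<le> indicator V y * (s - r)"
        by (intro mult_mono) (use bV b in auto)
      then show ?thesis using b(2)[of "norm y"] by (simp add: \<phi>_def abs_mult mult.commute)
    qed
    then have "((\<lambda>t. heat_convolution (\<lambda>y :: real ^ 'n. \<phi> (norm y) - \<psi> (norm y)) 0 t) \<longlongrightarrow> 0) at_top"
      by (intro heat_convolution_finite_measure_support_tendsto_0[OF _ V]) auto
    moreover have "((\<lambda>\<tau>. \<psi> (c * \<tau>) - \<psi> \<tau>) \<longlongrightarrow> 0) at_top" if "c > 0" for c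
    proof -
      have "((\<lambda>\<tau>. (\<beta> - \<alpha>) / 2 * (slow_wave (c * \<tau>) - slow_wave \<tau>)) \<longlongrightarrow> 0) at_top"
        by (rule tendsto_mult_right_zero[OF slow_wave_slow[OF that]])
      then show ?thesis by (simp add: \<psi>_def right_diff_distrib)
    qed
    then have "((\<lambda>t. heat_convolution (\<lambda>x :: real ^ 'n. \<psi> (norm x)) 0 t - \<psi> (sqrt t)) \<longlongrightarrow> 0) at_top"
      by (intro heat_convolution_slowly_varying[where M=M] M) auto
    ultimately have "((\<lambda>t. heat_convolution (\<lambda>y :: real ^ 'n. \<phi> (norm y) - \<psi> (norm y)) 0 t +
        (heat_convolution (\<lambda>x :: real ^ 'n. \<psi> (norm x)) 0 t - \<psi> (sqrt t))) \<longlongrightarrow> 0) at_top"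
      by (rule tendsto_add_zero)
    moreover have "\<forall>\<^sub>F t in at_top. heat_convolution (\<lambda>y :: real ^ 'n. \<phi> (norm y) - \<psi> (norm y)) 0 t +
        (heat_convolution (\<lambda>x :: real ^ 'n. \<psi> (norm x)) 0 t - \<psi> (sqrt t)) = u t - \<psi> (sqrt t)"
      using eventually_gt_at_top[of 0]
    proof eventually_elim
      case (elim t)
      show ?case
        by (subst heat_convolution_diff[OF elim, where M=M and M'=M]) (auto simp: M u_def)
    qed
    ultimately show ?thesis by (rule Lim_transform_eventually)
  qed
  note diff = this
  have close: "\<forall>\<^sub>F t in at_top. \<bar>u t - \<psi> (sqrt t)\<bar> < e" if "e > 0" for e
    using tendstoD[OF diff that] by (simp add: dist_real_def)
  \<comment> \<open>Along times at which \<open>\<psi> (sqrt t)\<close> has the constant value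
    \<open>c\<close>, the vanishing difference forces \<open>u\<close> to converge to
    \<open>c\<close>.\<close>
  have along: "(\<lambda>k. u (T k)) \<longlonglongrightarrow> c"
    if "filterlim T at_top sequentially" "\<And>k. \<psi> (sqrt (T k)) = c" for T :: "nat \<Rightarrow> real" and c
    using filterlim_compose[OF diff that(1)] that(2) by (simp add: LIM_zero_iff)
  have "Limsup at_top (\<lambda>\<tau>. ereal (\<phi> \<tau>)) = ereal s"
  proof (rule Limsup_eqI[where X="\<lambda>k. real (2 * k)"])
    show "\<forall>\<^sub>F \<tau> in at_top. \<phi> \<tau> < s + e" if "e > 0" for e
      using \<phi>(2) that by (intro always_eventually) (smt (verit))
    have "\<phi> (real (2 * k)) = s" for k
      unfolding \<phi>_def b(4) using cos_2npi[of k] by (simp add: g_def mult_ac field_simps)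
    then show "(\<lambda>k. \<phi> (real (2 * k))) \<longlonglongrightarrow> s" by (simp only: tendsto_const)
    show "LIM k sequentially. real (2 * k) :> at_top" by real_asymp
  qed
  moreover have "Liminf at_top (\<lambda>\<tau>. ereal (\<phi> \<tau>)) = ereal r"
  proof (rule Liminf_eqI[where X="\<lambda>k. real (2 * k + 1)"])
    show "\<forall>\<^sub>F \<tau> in at_top. r - e < \<phi> \<tau>" if "e > 0" for e
      using \<phi>(1) that by (intro always_eventually) (smt (verit))
    have "cos (pi * real (2 * k + 1)) = - 1" for k
      using cos_npi2[of "2 * k + 1"] by simp
    then have "\<phi> (real (2 * k + 1)) = r" for k
      unfolding \<phi>_def b(4) by (simp only: g_def) (simp add: field_simps)
    then show "(\<lambda>k. \<phi> (real (2 * k + 1))) \<longlonglongrightarrow> r" by (simp only: tendsto_const)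
    show "LIM k sequentially. real (2 * k + 1) :> at_top" by real_asymp
  qed
  moreover have "Limsup at_top (\<lambda>t. ereal (u t)) = ereal \<beta>"
  proof -
    obtain T where T: "filterlim T at_top sequentially" "\<And>k. slow_wave (sqrt (T k)) = sin (pi / 2)"
      using slow_wave_attains[of "pi / 2"] by auto
    show ?thesis
    proof (rule Limsup_eqI[OF _ T(1)])
      show "\<forall>\<^sub>F t in at_top. u t < \<beta> + e" if "e > 0" for e
        using close[OF that]
      proof eventually_elim
        case (elim t)
        then show ?case using \<psi>(2)[of "sqrt t"] by linarith
      qed
      show "(\<lambda>k. u (T k)) \<longlonglongrightarrow> \<beta>"
        by (rule along[OF T(1)]) (simp add: \<psi>_def T(2) field_simps)
    qed
  qed
  moreover have "Liminf at_top (\<lambda>t. ereal (u t)) = ereal \<alpha>"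
  proof -
    \<comment> \<open>The angle \<open>3 / 2 * pi\<close> is used for the value -1 of sine, as
      \<open>slow_wave_attains\<close> asks for a nonnegative angle.\<close>
    obtain T where T: "filterlim T at_top sequentially" "\<And>k. slow_wave (sqrt (T k)) = sin (3 / 2 * pi)"
      using slow_wave_attains[of "3 / 2 * pi"] by auto
    show ?thesis
    proof (rule Liminf_eqI[OF _ T(1)])
      show "\<forall>\<^sub>F t in at_top. \<alpha> - e < u t" if "e > 0" for e
        using close[OF that]
      proof eventually_elim
        case (elim t)
        then show ?case using \<psi>(1)[of "sqrt t"] by linarith
      qed
      show "(\<lambda>k. u (T k)) \<longlonglongrightarrow> \<alpha>"
        by (rule along[OF T(1)]) (simp only: \<psi>_def T(2) sin_3over2_pi, simp add: field_simps)
    qed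
  qed
  moreover have "continuous_on {0..} \<phi>" using cont_\<phi> by (rule continuous_on_subset) auto
  moreover have "bounded (\<phi> ` {0..})" using M(2) by (auto simp: bounded_iff)
  ultimately show ?thesis unfolding u_def by (intro exI[of _ \<phi>] conjI)
qed

end
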